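(* Let $d=2$ and let $\Omega\subset\mathbb R^d$ be a domain which either is star-shaped with respect to a ball of radius $\mathfrak R$, or admits a shape-regular decomposition into $\mathfrak N$ simplices. Let $\{\mathcal T_h\}$ be a family of shape-regular simplicial meshes of $\Omega$ with shape-regularity parameter $\gamma$, and let $p\in[1,d)$. Let $\widetilde C_{\rm SP}^*$ and $\widetilde C_{\rm ST}^\sharp$ be the positive constants, depending on $p$, $\Gamma_D$, $\Omega$ (through either $\mathfrak R$ or $\mathfrak N$), $d$, and $\gamma$, of the improved Sobolev–Poincaré and Sobolev-trace inequalities in broken Sobolev spaces, i.e., such that for all $v\in W^{1,p}_{\Gamma_D}(\mathcal T_h)$ one has $\|v\|_{L^q(\Omega)}\le \widetilde C_{\rm SP}^*|||v|||$ for all $q\in[1,p^*]$ and $\|v\|_{L^q(\Gamma)}\le \widetilde C_{\rm ST}^\sharp|||v|||$ for all $q\in[1,p^\sharp]$, where $$|||v|||=\|\nabla_h v\|_{\mathbf L^p(\Omega)}+\Big(\sum_{F\in\mathcal F_h^{ID}}\|\Pi_0^{0,\mathcal F_h}[\![v]\!]\|_{L^{p^\sharp}(F)}^p\Big)^{1/p}.$$ Then, for all $q_h\in \mathrm{CR}_{k,g_D}(\mathcal T_h,\mathcal F_h^D)$, with $g_D\in W^{\frac1\alpha,\alpha'}(\Gamma_D)$, $$\|q_h\|_{L^q(\Omega)}\le\widetilde C_{\rm SP}^*\Big[\|\nabla_h q_h\|_{\mathbf L^p(\Omega)}+\Big(\sum_{F\in\mathcal F_h^D}\|\Pi_0^{0,\mathcal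 F_h}g_D\|_{L^{p^\sharp}(F)}^p\Big)^{1/p}\Big]\qquad\forall q\in[1,p^*],$$ $$\|q_h\|_{L^q(\Gamma)}\le\widetilde C_{\rm ST}^\sharp\Big[\|\nabla_h q_h\|_{\mathbf L^p(\Omega)}+\Big(\sum_{F\in\mathcal F_h^D}\|\Pi_0^{0,\mathcal F_h}g_D\|_{L^{p^\sharp}(F)}^p\Big)^{1/p}\Big]\qquad\forall q\in[1,p^\sharp].$$
   Context: $\Omega$ is a bounded domain with boundary $\Gamma=\Gamma_D\cup\Gamma_N$. $\alpha>2$ is fixed, $\alpha'=\frac{\alpha}{\alpha-1}$, and $k\ge1$ is the polynomial order. For $p\in[1,d)$: $p^\sharp=\frac{p(d-1)}{d-p}$, $p^*=\frac{pd}{d-p}$. Meshes: each $\mathcal T_h$ is a finite collection of closed simplices $K$ with disjoint interiors and $\overline\Omega=\bigcup_{K}K$; $h_K$ is the diameter of $K$, $\mathfrak R_K$ the radius of the largest ball contained in $K$, and $h_K\le\gamma\,\mathfrak R_K$ for all $K$ and all meshes. The set $\mathcal F_h$ of facets consists of internal facets $F=\partial K_{1}\cap\partial K_{2}$ (set $\mathcal F_h^I$) and boundary facets; each boundary facet is contained either in $\Gamma_D$ (set $\mathcal F_h^D$) or in $\Gamma_N$. $\mathcal F_h^{ID}=\mathcal F_h^I\cup\mathcal F_h^D$. $\mathbf n_F$ is a fixed unit normal to $F$. $W^{1,p}(\mathcal T_h)=\{u\in L^p(\Omega): u_{|K}\in W^{1,p}(K)\ \forall K\in\mathcal T_h\}$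 is the broken Sobolev space; the notation $W^{1,p}_{\Gamma_D}(\mathcal T_h)$ denotes this same space, the subscript recalling that it is endowed with the functional $|||\cdot|||$, which involves the facets on $\Gamma_D$. $\nabla_h$ is the elementwise gradient. The jump on an internal facet is $[\![v]\!]=v_{|K_1}\mathbf n_{K_1}\cdot\mathbf n_F+v_{|K_2}\mathbf n_{K_2}\cdot\mathbf n_F$, with $\mathbf n_{K_i}$ the outward normal of $K_i$; on a boundary facet it is the trace of $v$. $\Pi^{0,\mathcal F_h}_0$ is the facetwise average operator. Crouzeix–Raviart space: $\mathrm{CR}_{k,g}(\mathcal T_h,\mathcal F_h^D)$ is the set of piecewise polynomials $q_h$ of degree at most $k$ on $\mathcal T_h$ such that $\int_F[\![q_h]\!]\,r\,ds=0$ for all $r\in\mathbb P_{k-1}(F)$, $F\in\mathcal F_h^I$, and $\int_F([\![q_h]\!]-g)\,r\,ds=0$ for all $r\in\mathbb P_{k-1}(F)$, $F\in\mathcal F_h^D$. *)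

theory Defs
  imports "HOL-Analysis.Analysis"
begin

section \<open>Lebesgue and Sobolev spaces\<close>

definition in_Lp :: "real \<Rightarrow> 'a measure \<Rightarrow> ('a \<Rightarrow> 'b::real_normed_vector) \<Rightarrow> bool" where
  "in_Lp p M f \<longleftrightarrow> f \<in> borel_measurable M \<and> integrable M (\<lambda>x. norm (f x) powr p)"

text \<open>Only meaningful together with \<open>in_Lp\<close>, since the integral of a non-integrable function
  is 0 by convention.\<close>
definition Lp_norm :: "real \<Rightarrow> 'a measure \<Rightarrow> ('a \<Rightarrow> 'b::real_normed_vector) \<Rightarrow> real" where
  "Lp_norm p M f = (\<integral>x. norm (f x) powr p \<partial>M) powr (1 / p)"

primrec C_fun :: "nat \<Rightarrow> ('a::euclidean_space \<Rightarrow> real) \<Rightarrow> bool" where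
  "C_fun 0 f \<longleftrightarrow> continuous_on UNIV f"
| "C_fun (Suc n) f \<longleftrightarrow> (\<exists>G. (\<forall>x. GDERIV f x :> G x) \<and> (\<forall>b\<in>Basis. C_fun n (\<lambda>x. G x \<bullet> b)))"

definition smooth :: "('a::euclidean_space \<Rightarrow> real) \<Rightarrow> bool" where
  "smooth f \<longleftrightarrow> (\<forall>n. C_fun n f)"

definition test_function :: "'a::euclidean_space set \<Rightarrow> ('a \<Rightarrow> real) \<Rightarrow> bool" where
  "test_function U \<phi> \<longleftrightarrow>
     smooth \<phi> \<and> compact (closure {x. \<phi> x \<noteq> 0}) \<and> closure {x. \<phi> x \<noteq> 0} \<subseteq> U"

definition locally_integrable ::
  "'a::euclidean_space set \<Rightarrow> ('a \<Rightarrow> 'b::euclidean_space) \<Rightarrow> bool" where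
  "locally_integrable U f \<longleftrightarrow> (\<forall>C. compact C \<and> C \<subseteq> U \<longrightarrow> integrable (lebesgue_on C) f)"

definition weak_gradient ::
  "'a::euclidean_space set \<Rightarrow> ('a \<Rightarrow> real) \<Rightarrow> ('a \<Rightarrow> 'a) \<Rightarrow> bool" where
  "weak_gradient U v G \<longleftrightarrow>
     locally_integrable U v \<and> locally_integrable U G \<and>
     (\<forall>\<phi> D. test_function U \<phi> \<and> (\<forall>x. GDERIV \<phi> x :> D x) \<longrightarrow>
        (\<integral>x. v x *\<^sub>R D x \<partial>lebesgue_on U) = - (\<integral>x. \<phi> x *\<^sub>R G x \<partial>lebesgue_on U))"

definition in_W1p :: "real \<Rightarrow> 'a::euclidean_space set \<Rightarrow> ('a \<Rightarrow> real) \<Rightarrow> bool" where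
  "in_W1p p U v \<longleftrightarrow>
     in_Lp p (lebesgue_on U) v \<and> (\<exists>G. weak_gradient U v G \<and> in_Lp p (lebesgue_on U) G)"


section \<open>Length measure\<close>

text \<open>One-dimensional Hausdorff measure, i.e. the surface measure on lines and polygons in the
  plane.  In dimension one the Hausdorff measure needs no normalising constant.  The outer measure
  below is a metric outer measure, hence countably additive on the Borel sets, as \<open>measure_of\<close>
  requires.\<close>

definition hausdorff1_pre :: "real \<Rightarrow> 'a::metric_space set \<Rightarrow> ennreal" where
  "hausdorff1_pre \<delta> A =
     (INF U \<in> {U :: nat \<Rightarrow> 'a set. A \<subseteq> (\<Union>i. U i) \<and> (\<forall>i. bounded (U i) \<and> diameter (U i) \<le> \<delta>)}.
        \<Sum>i. ennreal (diameter (U i)))"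

definition length_measure :: "'a::metric_space measure" where
  "length_measure = measure_of UNIV (sets borel) (\<lambda>A. SUP \<delta>\<in>{0<..}. hausdorff1_pre \<delta> A)"

abbreviation length_on :: "'a::metric_space set \<Rightarrow> 'a measure" where
  "length_on S \<equiv> restrict_space length_measure S"

text \<open>The Sobolev--Slobodeckij space \<open>W\<^bsup>s,p\<^esup>(S)\<close> with \<open>0 < s < 1\<close> on a one-dimensional set \<open>S\<close>:
  the exponent in the kernel is \<open>dim S + s p\<close>.\<close>
definition in_Wsp_curve :: "real \<Rightarrow> real \<Rightarrow> 'a::real_normed_vector set \<Rightarrow> ('a \<Rightarrow> real) \<Rightarrow> bool" where
  "in_Wsp_curve s p S g \<longleftrightarrow>
     in_Lp p (length_on S) g \<and>
     (\<integral>\<^sup>+ x. \<integral>\<^sup>+ y. ennreal (\<bar>g x - g y\<bar> powr p / dist x y powr (1 + s * p))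
        \<partial>length_on S \<partial>length_on S) < \<infinity>"


section \<open>Traces\<close>

text \<open>\<open>t\<close> is the trace on \<open>frontier K\<close> of \<open>v \<in> W\<^bsup>1,1\<^esup>(K)\<close>: \<open>v\<close> is approximated in
  \<open>W\<^bsup>1,1\<^esup>(K)\<close> by functions smooth up to the boundary, whose restrictions converge to \<open>t\<close>
  in \<open>L\<^sup>1\<close>.  As simplices are bounded, \<open>W\<^bsup>1,p\<^esup>(K)\<close> is contained in \<open>W\<^bsup>1,1\<^esup>(K)\<close>, so this
  is the trace for every \<open>p \<ge> 1\<close>.\<close>
definition is_trace :: "(real^2) set \<Rightarrow> (real^2 \<Rightarrow> real) \<Rightarrow> (real^2 \<Rightarrow> real) \<Rightarrow> bool" where
  "is_trace K v t \<longleftrightarrow>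
     in_Lp 1 (lebesgue_on (interior K)) v \<and> in_Lp 1 (length_on (frontier K)) t \<and>
     (\<exists>G \<phi> D.
        weak_gradient (interior K) v G \<and> in_Lp 1 (lebesgue_on (interior K)) G \<and>
        (\<forall>n. smooth (\<phi> n)) \<and> (\<forall>n x. GDERIV (\<phi> n) x :> D n x) \<and>
        (\<lambda>n::nat. Lp_norm 1 (lebesgue_on (interior K)) (\<lambda>x. \<phi> n x - v x)) \<longlonglongrightarrow> 0 \<and>
        (\<lambda>n. Lp_norm 1 (lebesgue_on (interior K)) (\<lambda>x. D n x - G x)) \<longlonglongrightarrow> 0 \<and>
        (\<lambda>n. Lp_norm 1 (length_on (frontier K)) (\<lambda>x. \<phi> n x - t x)) \<longlonglongrightarrow> 0)"

text \<open>Determined up to a set of length zero.\<close>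
definition trace_on :: "(real^2) set \<Rightarrow> (real^2 \<Rightarrow> real) \<Rightarrow> real^2 \<Rightarrow> real" where
  "trace_on K v = (SOME t. is_trace K v t)"


section \<open>Domains and meshes\<close>

definition bounded_domain :: "'a::euclidean_space set \<Rightarrow> bool" where
  "bounded_domain \<Omega> \<longleftrightarrow> open \<Omega> \<and> connected \<Omega> \<and> bounded \<Omega> \<and> \<Omega> \<noteq> {}"

definition star_shaped_wrt_ball :: "real \<Rightarrow> 'a::euclidean_space set \<Rightarrow> bool" where
  "star_shaped_wrt_ball R \<Omega> \<longleftrightarrow> R > 0 \<and>
     (\<exists>c. ball c R \<subseteq> \<Omega> \<and> (\<forall>y\<in>ball c R. \<forall>x\<in>\<Omega>. closed_segment y x \<subseteq> \<Omega>))"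

definition inradius :: "'a::euclidean_space set \<Rightarrow> real" where
  "inradius K = Sup {r. 0 \<le> r \<and> (\<exists>c. cball c r \<subseteq> K)}"

definition simplicial_mesh :: "(real^2) set \<Rightarrow> (real^2) set set \<Rightarrow> bool" where
  "simplicial_mesh \<Omega> \<T> \<longleftrightarrow>
     finite \<T> \<and> (\<forall>K\<in>\<T>. 2 simplex K) \<and>
     (\<forall>K\<in>\<T>. \<forall>L\<in>\<T>. K \<noteq> L \<longrightarrow> interior K \<inter> interior L = {}) \<and>
     \<Union>\<T> = closure \<Omega>"

definition shape_regular :: "real \<Rightarrow> (real^2) set set \<Rightarrow> bool" where
  "shape_regular \<gamma> \<T> \<longleftrightarrow> (\<forall>K\<in>\<T>. diameter K \<le> \<gamma> * inradius K)"

text \<open>Positive length excludes elements that meet only in a vertex, and edges that touch the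
  boundary of the domain only at their end points.\<close>

definition internal_facets :: "(real^2) set \<Rightarrow> (real^2) set set \<Rightarrow> (real^2) set set" where
  "internal_facets \<Omega> \<T> =
     {F. (\<exists>K\<in>\<T>. \<exists>L\<in>\<T>. K \<noteq> L \<and> F = frontier K \<inter> frontier L) \<and>
         emeasure length_measure F > 0 \<and> \<not> F \<subseteq> frontier \<Omega>}"

definition boundary_facets :: "(real^2) set \<Rightarrow> (real^2) set set \<Rightarrow> (real^2) set set" where
  "boundary_facets \<Omega> \<T> =
     {F. (\<exists>K\<in>\<T>. \<exists>E. E facet_of K \<and> F = E \<inter> frontier \<Omega>) \<and> emeasure length_measure F > 0}"

definition dirichlet_facets ::
  "(real^2) set \<Rightarrow> (real^2) set \<Rightarrow> (real^2) set set \<Rightarrow> (real^2) set set" where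
  "dirichlet_facets \<Omega> \<Gamma>D \<T> = {F \<in> boundary_facets \<Omega> \<T>. F \<subseteq> \<Gamma>D}"

definition unit_normal :: "(real^2) set \<Rightarrow> real^2 \<Rightarrow> bool" where
  "unit_normal F n \<longleftrightarrow> norm n = 1 \<and> (\<forall>x\<in>F. \<forall>y\<in>F. n \<bullet> (x - y) = 0)"

definition outward_normal :: "(real^2) set \<Rightarrow> (real^2) set \<Rightarrow> real^2" where
  "outward_normal K F = (THE n. unit_normal F n \<and> (\<forall>x\<in>F. \<forall>y\<in>K. n \<bullet> (y - x) \<le> 0))"


section \<open>Broken Sobolev spaces\<close>

definition broken_W1p ::
  "real \<Rightarrow> (real^2) set \<Rightarrow> (real^2) set set \<Rightarrow> (real^2 \<Rightarrow> real) set" where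
  "broken_W1p p \<Omega> \<T> = {v. in_Lp p (lebesgue_on \<Omega>) v \<and> (\<forall>K\<in>\<T>. in_W1p p (interior K) v)}"

definition broken_grad :: "(real^2) set set \<Rightarrow> (real^2 \<Rightarrow> real) \<Rightarrow> real^2 \<Rightarrow> real^2" where
  "broken_grad \<T> v = (SOME G. \<forall>K\<in>\<T>. weak_gradient (interior K) v G)"

text \<open>On an internal facet the sum runs over the two elements sharing it; a boundary facet
  belongs to a single element.  \<open>nF\<close> assigns the fixed unit normals to the facets.\<close>
definition jump ::
  "(real^2) set \<Rightarrow> (real^2) set set \<Rightarrow> ((real^2) set \<Rightarrow> real^2) \<Rightarrow> (real^2) set
     \<Rightarrow> (real^2 \<Rightarrow> real) \<Rightarrow> real^2 \<Rightarrow> real" where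
  "jump \<Omega> \<T> nF F v x =
     (if F \<in> internal_facets \<Omega> \<T>
      then (\<Sum>K | K \<in> \<T> \<and> F \<subseteq> frontier K. trace_on K v x * (outward_normal K F \<bullet> nF F))
      else trace_on (SOME K. K \<in> \<T> \<and> F \<subseteq> frontier K) v x)"

definition facet_average :: "(real^2) set \<Rightarrow> (real^2 \<Rightarrow> real) \<Rightarrow> real^2 \<Rightarrow> real" where
  "facet_average F w = (\<lambda>_. (\<integral>x. w x \<partial>length_on F) / measure length_measure F)"

text \<open>\<open>d\<close> is the space dimension.\<close>

definition sharp_exponent :: "nat \<Rightarrow> real \<Rightarrow> real" where
  "sharp_exponent d p = p * (real d - 1) / (real d - p)"

definition star_exponent :: "nat \<Rightarrow> real \<Rightarrow> real" where
  "star_exponent d p = p * real d / (real d - p)"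

definition broken_norm ::
  "real \<Rightarrow> (real^2) set \<Rightarrow> (real^2) set \<Rightarrow> (real^2) set set \<Rightarrow> ((real^2) set \<Rightarrow> real^2)
     \<Rightarrow> (real^2 \<Rightarrow> real) \<Rightarrow> real" where
  "broken_norm p \<Omega> \<Gamma>D \<T> nF v =
     Lp_norm p (lebesgue_on \<Omega>) (broken_grad \<T> v) +
     (\<Sum>F \<in> internal_facets \<Omega> \<T> \<union> dirichlet_facets \<Omega> \<Gamma>D \<T>.
        Lp_norm (sharp_exponent 2 p) (length_on F) (facet_average F (jump \<Omega> \<T> nF F v)) powr p)
     powr (1 / p)"

text \<open>\<open>L\<^sup>q\<close> space and norm on \<open>\<Gamma> = frontier \<Omega>\<close> of a broken function: on the part of \<open>\<Gamma>\<close> lying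
  on the boundary of an element, the trace is taken from that element.\<close>

definition in_Lq_boundary ::
  "real \<Rightarrow> (real^2) set \<Rightarrow> (real^2) set set \<Rightarrow> (real^2 \<Rightarrow> real) \<Rightarrow> bool" where
  "in_Lq_boundary q \<Omega> \<T> v \<longleftrightarrow>
     (\<forall>K\<in>\<T>. in_Lp q (length_on (frontier K \<inter> frontier \<Omega>)) (trace_on K v))"

definition Lq_norm_boundary ::
  "real \<Rightarrow> (real^2) set \<Rightarrow> (real^2) set set \<Rightarrow> (real^2 \<Rightarrow> real) \<Rightarrow> real" where
  "Lq_norm_boundary q \<Omega> \<T> v =
     (\<Sum>K\<in>\<T>. \<integral>x. \<bar>trace_on K v x\<bar> powr q \<partial>length_on (frontier K \<inter> frontier \<Omega>)) powr (1 / q)"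


section \<open>Crouzeix--Raviart spaces\<close>

definition poly_le :: "nat \<Rightarrow> (real^2 \<Rightarrow> real) \<Rightarrow> bool" where
  "poly_le k P \<longleftrightarrow>
     (\<exists>c :: nat \<Rightarrow> nat \<Rightarrow> real. \<forall>x. P x = (\<Sum>i\<le>k. \<Sum>j\<le>k - i. c i j * (x $ 1) ^ i * (x $ 2) ^ j))"

text \<open>For \<open>k \<ge> 1\<close>.  Polynomials on a facet are the restrictions of polynomials on the plane.\<close>
definition CR_space ::
  "nat \<Rightarrow> (real^2 \<Rightarrow> real) \<Rightarrow> (real^2) set \<Rightarrow> (real^2) set \<Rightarrow> (real^2) set set
     \<Rightarrow> ((real^2) set \<Rightarrow> real^2) \<Rightarrow> (real^2 \<Rightarrow> real) set" where
  "CR_space k g \<Omega> \<Gamma>D \<T> nF =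
     {q. (\<forall>K\<in>\<T>. \<exists>P. poly_le k P \<and> (\<forall>x\<in>interior K. q x = P x)) \<and>
         (\<forall>F\<in>internal_facets \<Omega> \<T>. \<forall>r. poly_le (k - 1) r \<longrightarrow>
            (\<integral>x. jump \<Omega> \<T> nF F q x * r x \<partial>length_on F) = 0) \<and>
         (\<forall>F\<in>dirichlet_facets \<Omega> \<Gamma>D \<T>. \<forall>r. poly_le (k - 1) r \<longrightarrow>
            (\<integral>x. (jump \<Omega> \<T> nF F q x - g x) * r x \<partial>length_on F) = 0)}"

end

(* Since k \<ge> 1, the Crouzeix-Raviart conditions may be tested with r = 1: the facet averages of
   the jumps of q_h vanish on internal facets and agree with those of g_D on Dirichlet facets, so
   the broken norm of q_h is bounded by the right-hand side.  On Dirichlet facets, splitting the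
   integral of the difference requires the trace of q_h and g_D to be separately integrable; for the
   trace this holds because the polynomial itself is a trace of q_h and edges have finite length.
   The broken inequalities apply because a piecewise polynomial is in the broken Sobolev space: its
   weak gradient on an element is the classical one, by integration by parts. *)
theory Submission
  imports Defs
begin

section \<open>Smooth functions and weak gradients\<close>

lemma GDERIV_unique:
  assumes "GDERIV f x :> D" "GDERIV f x :> E"
  shows "D = E"
proof -
  have "(\<lambda>h. h \<bullet> D) = (\<lambda>h. h \<bullet> E)"
    using assms unfolding gderiv_def by (rule has_derivative_unique)
  then show ?thesis
    by (metis vector_eq_ldot)
qed

text \<open>Differentiation is local. Applied to the complement of a compact set, this shows that
  the gradient of a compactly supported function vanishes off the same set.\<close>

lemma GDERIV_zero_on_open:
  assumes "GDERIV f x :> D" "open S" "x \<in> S" "\<And>y. y \<in> S \<Longrightarrow> f y = 0"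
  shows "D = 0"
proof -
  have "GDERIV f x :> 0"
    unfolding gderiv_def inner_zero_right
    by (rule has_derivative_transform_within_open[OF has_derivative_const[of 0] assms(2,3)])
       (simp add: assms(4))
  with assms(1) show ?thesis
    by (rule GDERIV_unique)
qed

lemma C_fun_continuous: "C_fun n f \<Longrightarrow> continuous_on UNIV f"
proof (cases n)
  case (Suc m)
  assume "C_fun n f"
  then obtain G where "\<And>x. GDERIV f x :> G x"
    using Suc by auto
  then have "f differentiable_on UNIV"
    unfolding gderiv_def differentiable_on_def differentiable_def by blast
  then show ?thesis
    by (rule differentiable_imp_continuous_on)
qed simp

text \<open>The gradient of a product contains the factors themselves besides their gradients, so
  \<open>C_fun_mult\<close> has to lower the order of its factors by one.\<close>

lemma C_fun_Suc_D: "C_fun (Suc n) f \<Longrightarrow> C_fun n f"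
proof (induction n arbitrary: f)
  case 0
  then show ?case
    using C_fun_continuous C_fun.simps(1) by blast
next
  case (Suc n)
  \<comment> \<open>Only the outer order is unfolded; the components then have order
    \<open>Suc n\<close>, which the induction hypothesis lowers.\<close>
  then obtain G where G: "\<forall>x. GDERIV f x :> G x" "\<forall>b\<in>Basis. C_fun (Suc n) (\<lambda>x. G x \<bullet> b)"
    unfolding C_fun.simps(2)[of "Suc n"] by blast
  then have "\<forall>b\<in>Basis. C_fun n (\<lambda>x. G x \<bullet> b)"
    using Suc.IH by blast
  then show ?case
    using G(1) by auto
qed

lemma C_fun_const: "C_fun n (\<lambda>x. c)"
proof (induction n arbitrary: c)
  case (Suc n)
  have "\<forall>x. GDERIV (\<lambda>x. c) x :> 0"
    by (simp add: GDERIV_const)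
  then show ?case
    using Suc unfolding C_fun.simps by (intro exI[of _ "\<lambda>x. 0"]) auto
qed simp

lemma C_fun_inner: "C_fun n (\<lambda>x. x \<bullet> b)"
proof (cases n)
  case (Suc m)
  have "\<forall>x. GDERIV (\<lambda>x. x \<bullet> b) x :> b"
    unfolding gderiv_def by (auto intro!: derivative_eq_intros)
  then show ?thesis
    unfolding Suc C_fun.simps by (intro exI[of _ "\<lambda>x. b"]) (simp add: C_fun_const)
qed (auto intro!: continuous_intros)

lemma C_fun_add: "C_fun n f \<Longrightarrow> C_fun n g \<Longrightarrow> C_fun n (\<lambda>x. f x + g x)"
proof (induction n arbitrary: f g)
  case (Suc n)
  then obtain F G where
    F: "\<forall>x. GDERIV f x :> F x" "\<forall>b\<in>Basis. C_fun n (\<lambda>x. F x \<bullet> b)" and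
    G: "\<forall>x. GDERIV g x :> G x" "\<forall>b\<in>Basis. C_fun n (\<lambda>x. G x \<bullet> b)"
    by auto
  show ?case
    unfolding C_fun.simps using F G
    by (intro exI[of _ "\<lambda>x. F x + G x"]) (auto simp: inner_add_left intro: GDERIV_add Suc.IH)
qed (simp add: continuous_on_add)

lemma C_fun_mult: "C_fun n f \<Longrightarrow> C_fun n g \<Longrightarrow> C_fun n (\<lambda>x. f x * g x)"
proof (induction n arbitrary: f g)
  case (Suc n)
  then obtain F G where
    F: "\<forall>x. GDERIV f x :> F x" "\<forall>b\<in>Basis. C_fun n (\<lambda>x. F x \<bullet> b)" and
    G: "\<forall>x. GDERIV g x :> G x" "\<forall>b\<in>Basis. C_fun n (\<lambda>x. G x \<bullet> b)"
    by auto
  have "C_fun n f" "C_fun n g"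
    using Suc.prems by (blast intro: C_fun_Suc_D)+
  then show ?case
    unfolding C_fun.simps using F G
    by (intro exI[of _ "\<lambda>x. f x *\<^sub>R G x + g x *\<^sub>R F x"])
       (auto simp: inner_add_left intro!: GDERIV_mult C_fun_add Suc.IH)
qed (simp add: continuous_on_mult)

lemma smooth_const: "smooth (\<lambda>x. c)"
  by (simp add: smooth_def C_fun_const)

lemma smooth_inner: "smooth (\<lambda>x. x \<bullet> b)"
  by (simp add: smooth_def C_fun_inner)

lemma smooth_add: "smooth f \<Longrightarrow> smooth g \<Longrightarrow> smooth (\<lambda>x. f x + g x)"
  by (simp add: smooth_def C_fun_add)

lemma smooth_mult: "smooth f \<Longrightarrow> smooth g \<Longrightarrow> smooth (\<lambda>x. f x * g x)"
  by (simp add: smooth_def C_fun_mult)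

lemma smooth_power: "smooth f \<Longrightarrow> smooth (\<lambda>x. f x ^ n)"
  by (induction n) (auto intro: smooth_const smooth_mult)

lemma smooth_sum: "(\<And>i. i \<in> I \<Longrightarrow> smooth (f i)) \<Longrightarrow> smooth (\<lambda>x. \<Sum>i\<in>I. f i x)"
  by (induction I rule: infinite_finite_induct) (auto intro: smooth_const smooth_add)

lemma smooth_continuous: "smooth f \<Longrightarrow> continuous_on UNIV f"
  using C_fun_continuous smooth_def by blast

lemma smooth_has_gradient:
  assumes "smooth f"
  obtains G where "\<And>x. GDERIV f x :> G x"
  using assms unfolding smooth_def by (metis C_fun.simps(2))

text \<open>\<open>C_fun\<close> supplies just some gradient field with continuous components;
  uniqueness of gradients identifies it with the given \<open>G\<close>.\<close>

lemma smooth_gradient_continuous: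
  assumes "smooth f" "\<And>x. GDERIV f x :> G x"
  shows "continuous_on UNIV G"
proof -
  have "C_fun (Suc 0) f"
    using assms(1) smooth_def by blast
  then obtain H where H: "\<And>x. GDERIV f x :> H x" "\<And>b. b \<in> Basis \<Longrightarrow> continuous_on UNIV (\<lambda>x. H x \<bullet> b)"
    by auto
  have "G = H"
    using GDERIV_unique assms(2) H(1) by blast
  then show ?thesis
    using H(2) continuous_on_componentwise by blast
qed

lemma smooth_poly_le:
  assumes "poly_le k P"
  shows "smooth P"
proof -
  obtain c where c: "P = (\<lambda>x. \<Sum>i\<le>k. \<Sum>j\<le>k - i. c i j * (x $ 1) ^ i * (x $ 2) ^ j)"
    using assms unfolding poly_le_def by blast
  have "smooth (\<lambda>x :: real^2. x $ i)" for i
    using smooth_inner[of "axis i 1"] by (simp add: cart_eq_inner_axis)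
  then show ?thesis
    unfolding c by (intro smooth_sum smooth_mult smooth_power smooth_const)
qed

text \<open>Makes r = 1 an admissible test function in the Crouzeix-Raviart conditions of every
  order.\<close>

lemma poly_le_one: "poly_le k (\<lambda>x. 1)"
proof -
  define c :: "nat \<Rightarrow> nat \<Rightarrow> real" where "c i j = (if i = 0 \<and> j = 0 then 1 else 0)" for i j
  have "(\<Sum>i\<le>k. \<Sum>j\<le>k - i. c i j * (x $ 1) ^ i * (x $ 2) ^ j) = 1" for x :: "real^2"
  proof -
    have "(\<Sum>j\<le>k - i. c i j * (x $ 1) ^ i * (x $ 2) ^ j) = (if i = 0 then 1 else 0)" for i
      by (cases "i = 0") (simp_all add: c_def if_distrib[of "\<lambda>t. t * _"] cong: if_cong)
    then show ?thesis
      by simp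
  qed
  then show ?thesis
    unfolding poly_le_def by (intro exI[of _ c]) simp
qed

section \<open>Integration by parts against test functions\<close>

lemma integrable_lborel_compact_support:
  fixes f :: "'a::euclidean_space \<Rightarrow> 'b::{banach, second_countable_topology}"
  assumes "continuous_on UNIV f" "compact C" "\<And>x. x \<notin> C \<Longrightarrow> f x = 0"
  shows "integrable lborel f"
proof -
  have "(\<lambda>x. indicator C x *\<^sub>R f x) = f"
    using assms(3) by (auto simp: indicator_def)
  then show ?thesis
    using borel_integrable_compact[OF assms(2) continuous_on_subset[OF assms(1)]] by simp
qed

text \<open>The integrals of difference quotients vanish by translation invariance.\<close>
lemma integral_gradient_eq_0:
  fixes f :: "'a::euclidean_space \<Rightarrow> real"
  assumes der: "\<And>x. GDERIV f x :> G x" and cont: "continuous_on UNIV G"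
    and C: "compact C" "\<And>x. x \<notin> C \<Longrightarrow> f x = 0"
  shows "(\<integral>x. G x \<partial>lborel) = 0"
proof -
  have f_cont: "continuous_on UNIV f"
    using der unfolding gderiv_def
    by (meson continuous_at_imp_continuous_on has_derivative_continuous)
  have f_meas [measurable]: "f \<in> borel_measurable borel" 
    and G_meas [measurable]: "G \<in> borel_measurable borel"
    using f_cont cont by (simp_all add: borel_measurable_continuous_onI)
  have G0: "G x = 0" if "x \<notin> C" for x
    using GDERIV_zero_on_open[OF der open_Compl[OF compact_imp_closed[OF C(1)]]] C(2) that by simp
  \<comment> \<open>A global bound on the gradient, by compactness of \<open>C\<close> and vanishing
    elsewhere; it becomes the Lipschitz constant of \<open>f\<close>.\<close>
  obtain M where M: "M \<ge> 0" "\<And>x. norm (G x) \<le> M"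
  proof -
    have "bounded (G ` C)"
      by (intro compact_imp_bounded compact_continuous_image C continuous_on_subset[OF cont]) auto
    then obtain M where "M > 0" "\<And>x. x \<in> C \<Longrightarrow> norm (G x) \<le> M"
      by (auto simp: bounded_pos)
    then have "norm (G x) \<le> M" for x
      using G0[of x] by (cases "x \<in> C") auto
    with \<open>M > 0\<close> show ?thesis
      by (intro that[of M]) auto
  qed
  have lip: "\<bar>f x - f y\<bar> \<le> M * norm (x - y)" for x y
  proof -
    have "norm (f x - f y) \<le> M * norm (x - y)"
    proof (rule differentiable_bound[of UNIV f "\<lambda>x h. h \<bullet> G x"])
      show "onorm (\<lambda>h. h \<bullet> G x) \<le> M" for x
      proof (rule onorm_le)
        fix h
        have "norm (h \<bullet> G x) \<le> norm h * norm (G x)"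
          by (simp add: Cauchy_Schwarz_ineq2)
        also have "\<dots> \<le> norm h * M"
          by (intro mult_left_mono M) auto
        finally show "norm (h \<bullet> G x) \<le> M * norm h"
          by (simp add: mult.commute)
      qed
    qed (use der in \<open>auto simp: gderiv_def\<close>)
    then show ?thesis by simp
  qed
  obtain r where r: "C \<subseteq> ball 0 r"
    using bounded_subset_ballD[OF compact_imp_bounded[OF C(1)]] by blast
  have f_int: "integrable lborel f" and G_int: "integrable lborel G"
    using integrable_lborel_compact_support f_cont cont C G0 by blast+
  have "(\<integral>x. G x \<partial>lborel) \<bullet> b = 0" if b: "b \<in> Basis" for b
  proof -
    \<comment> \<open>Difference quotients with steps 1/(n+1). Steps of at most 1 keep their
      supports inside \<open>cball 0 (r + 1)\<close>, where the Lipschitz constant \<open>M\<close>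
      dominates them.\<close>
    define t where "t n = inverse (real (Suc n))" for n
    have t: "0 < t n" "t n \<le> 1" for n
      by (auto simp: t_def field_simps)
    define s where "s n x = (f (t n *\<^sub>R b + x) - f x) / t n" for n x
    have s_meas [measurable]: "s n \<in> borel_measurable borel" for n
      unfolding s_def by measurable
    have "(\<integral>x. s n x \<partial>lborel) = 0" for n
    proof -
      have *: "integrable (distr lborel borel ((+) (t n *\<^sub>R b))) f"
        using f_int by (simp add: lborel_distr_plus)
      have 1: "integrable lborel (\<lambda>x. f (t n *\<^sub>R b + x))"
        using * by (subst (asm) integrable_distr_eq) auto
      have "(\<integral>x. f (t n *\<^sub>R b + x) \<partial>lborel) = (\<integral>x. f x \<partial>distr lborel borel ((+) (t n *\<^sub>R b)))"
        by (subst integral_distr) auto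
      also have "\<dots> = (\<integral>x. f x \<partial>lborel)"
        by (simp add: lborel_distr_plus)
      finally show ?thesis
        using 1 f_int by (simp add: s_def)
    qed
    moreover have "(\<lambda>n. \<integral>x. s n x \<partial>lborel) \<longlonglongrightarrow> (\<integral>x. G x \<bullet> b \<partial>lborel)"
    proof (rule integral_dominated_convergence)
      show "integrable lborel (\<lambda>x. M * indicator (cball 0 (r + 1)) x :: real)"
        using borel_integrable_compact[OF compact_cball continuous_on_const, of 0 "r + 1" M]
        by (simp only: real_scaleR_def mult.commute)
      show "AE x in lborel. norm (s n x) \<le> M * indicator (cball 0 (r + 1)) x" for n
      proof (rule AE_I2)
        fix x
        show "norm (s n x) \<le> M * indicator (cball 0 (r + 1)) x"
        proof (cases "x \<in> cball 0 (r + 1)")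
          case True
          have "\<bar>f (t n *\<^sub>R b + x) - f x\<bar> \<le> M * t n"
            using lip[of "t n *\<^sub>R b + x" x] b t(1)[of n] by simp
          then show ?thesis
            using True t(1)[of n] by (simp add: s_def field_simps)
        next
          case False
          have "norm x \<le> norm (t n *\<^sub>R b + x) + norm (t n *\<^sub>R b)"
            by (metis add_diff_cancel_left' norm_triangle_ineq4)
          also have "norm (t n *\<^sub>R b) \<le> 1"
            using b t[of n] by simp
          finally have "t n *\<^sub>R b + x \<notin> ball 0 r" "x \<notin> ball 0 r"
            using False by auto
          then have "f (t n *\<^sub>R b + x) = 0" "f x = 0"
            using C(2) r by blast+
          then show ?thesis
            using False by (simp add: s_def)
        qed
      qed
      show "AE x in lborel. (\<lambda>n. s n x) \<longlonglongrightarrow> G x \<bullet> b"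
      proof (rule AE_I2)
        fix x
        have "((\<lambda>u. f (u *\<^sub>R b + x)) has_derivative (\<lambda>u. (u *\<^sub>R b) \<bullet> G x)) (at 0)"
          using der[of x] unfolding gderiv_def
          by (intro has_derivative_compose[of "\<lambda>u. u *\<^sub>R b + x" "\<lambda>u. u *\<^sub>R b" 0 UNIV f])
             (auto intro!: derivative_eq_intros)
        then have "((\<lambda>u. f (u *\<^sub>R b + x)) has_field_derivative (G x \<bullet> b)) (at 0)"
          unfolding has_field_derivative_def by (simp add: inner_commute mult.commute[of _ "b \<bullet> G x"] fun_eq_iff)
        then have "(\<lambda>u. (f (u *\<^sub>R b + x) - f x) / u) \<midarrow>0\<rightarrow> G x \<bullet> b"
          by (simp add: has_field_derivative_iff)
        moreover have "filterlim t (at 0) sequentially"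
          unfolding filterlim_at using t(1) LIMSEQ_inverse_real_of_nat
          by (auto simp: t_def[abs_def] less_imp_neq[symmetric])
        ultimately show "(\<lambda>n. s n x) \<longlonglongrightarrow> G x \<bullet> b"
          unfolding s_def by (rule filterlim_compose)
      qed
    qed auto
    ultimately have "(\<integral>x. G x \<bullet> b \<partial>lborel) = 0"
      by (simp add: LIMSEQ_const_iff)
    then show ?thesis
      using G_int by simp
  qed
  then show ?thesis
    using euclidean_all_zero_iff by blast
qed

text \<open>Agreement of \<open>v\<close> with \<open>f\<close> is asked on \<open>U\<close> alone,
  since a piecewise polynomial is a single polynomial only inside one element.\<close>

lemma locally_integrable_continuous:
  fixes f :: "'a::euclidean_space \<Rightarrow> 'b::euclidean_space"
  assumes "continuous_on UNIV f" "\<And>x. x \<in> U \<Longrightarrow> v x = f x"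
  shows "locally_integrable U v"
  unfolding locally_integrable_def
proof safe
  fix C assume C: "compact C" "C \<subseteq> U"
  have "integrable lborel (\<lambda>x. indicator C x *\<^sub>R f x)"
    using borel_integrable_compact C continuous_on_subset[OF assms(1)] by blast
  then have "integrable lebesgue (\<lambda>x. indicator C x *\<^sub>R f x)"
    by (simp add: integrable_completion borel_measurable_integrable)
  then have "integrable (lebesgue_on C) f"
    using C by (subst integrable_restrict_space) (auto simp: borel_compact)
  then show "integrable (lebesgue_on C) v"
    by (rule Bochner_Integration.integrable_cong[THEN iffD1, rotated -1])
       (use assms(2) C in \<open>auto simp: space_restrict_space\<close>)
qed

text \<open>The product of \<open>f\<close> with a test function has compact support, so its
  gradient, given by the product rule, integrates to zero. Replacing \<open>f\<close> by
  \<open>v\<close> is harmless because the test function and its gradient vanish off a compact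
  subset of \<open>U\<close>.\<close>

lemma weak_gradient_smooth:
  assumes U: "open U" and f: "smooth f" "\<And>x. GDERIV f x :> G x"
    and v: "\<And>x. x \<in> U \<Longrightarrow> v x = f x"
  shows "weak_gradient U v G"
  unfolding weak_gradient_def
proof (intro conjI allI impI)
  have fc: "continuous_on UNIV f" and Gc: "continuous_on UNIV G"
    using f smooth_continuous smooth_gradient_continuous by blast+
  show "locally_integrable U v" "locally_integrable U G"
    using fc Gc v by (auto intro: locally_integrable_continuous)
  fix \<phi> D
  assume *: "test_function U \<phi> \<and> (\<forall>x. GDERIV \<phi> x :> D x)"
  define C where "C = closure {x. \<phi> x \<noteq> 0}"
  have \<phi>: "smooth \<phi>" "\<And>x. GDERIV \<phi> x :> D x" and C: "compact C" "C \<subseteq> U"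
    using * by (auto simp: test_function_def C_def)
  have \<phi>c: "continuous_on UNIV \<phi>" and Dc: "continuous_on UNIV D"
    using \<phi> smooth_continuous smooth_gradient_continuous by blast+
  have \<phi>0: "\<phi> x = 0" if "x \<notin> C" for x
    using that closure_subset[of "{x. \<phi> x \<noteq> 0}"] by (auto simp: C_def)
  have D0: "D x = 0" if "x \<notin> C" for x
    using GDERIV_zero_on_open[OF \<phi>(2) open_Compl[OF compact_imp_closed[OF C(1)]]] \<phi>0 that by simp
  \<comment> \<open>Passes from Lebesgue measure on \<open>U\<close> to \<open>lborel\<close> on the
    whole space, where \<open>integral_gradient_eq_0\<close> applies; the integrand vanishes off
    \<open>C\<close>, a subset of \<open>U\<close>.\<close>
  have int: "(\<integral>x. w x \<partial>lebesgue_on U) = (\<integral>x. h x \<partial>lborel)"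
    if "continuous_on UNIV h" "\<And>x. x \<notin> C \<Longrightarrow> h x = 0" "\<And>x. x \<in> U \<Longrightarrow> w x = h x"
    for w h :: "'a \<Rightarrow> 'a"
  proof -
    have "(\<lambda>x. indicator U x *\<^sub>R w x) = h"
      using that(2,3) C(2) by (auto simp: indicator_def fun_eq_iff)
    then have "(\<integral>x. w x \<partial>lebesgue_on U) = (\<integral>x. h x \<partial>lebesgue)"
      using U by (subst integral_restrict_space) auto
    also have "\<dots> = (\<integral>x. h x \<partial>lborel)"
      using that(1) by (intro integral_completion) (simp add: borel_measurable_continuous_onI)
    finally show ?thesis .
  qed
  have c1: "continuous_on UNIV (\<lambda>x. f x *\<^sub>R D x)" and c2: "continuous_on UNIV (\<lambda>x. \<phi> x *\<^sub>R G x)"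
    using fc Gc \<phi>c Dc by (auto intro: continuous_on_scaleR)
  have "(\<integral>x. f x *\<^sub>R D x + \<phi> x *\<^sub>R G x \<partial>lborel) = 0"
  proof (rule integral_gradient_eq_0)
    show "GDERIV (\<lambda>x. f x * \<phi> x) x :> f x *\<^sub>R D x + \<phi> x *\<^sub>R G x" for x
      by (rule GDERIV_mult[OF f(2) \<phi>(2)])
  qed (use c1 c2 C(1) \<phi>0 in \<open>auto intro: continuous_on_add\<close>)
  moreover have "integrable lborel (\<lambda>x. f x *\<^sub>R D x)" "integrable lborel (\<lambda>x. \<phi> x *\<^sub>R G x)"
    using c1 c2 C(1) D0 \<phi>0 by (auto intro!: integrable_lborel_compact_support[where C = C])
  ultimately have "(\<integral>x. f x *\<^sub>R D x \<partial>lborel) = - (\<integral>x. \<phi> x *\<^sub>R G x \<partial>lborel)"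
    by (simp add: eq_neg_iff_add_eq_0)
  moreover have "(\<integral>x. v x *\<^sub>R D x \<partial>lebesgue_on U) = (\<integral>x. f x *\<^sub>R D x \<partial>lborel)"
    by (rule int) (use c1 D0 v in auto)
  moreover have "(\<integral>x. \<phi> x *\<^sub>R G x \<partial>lebesgue_on U) = (\<integral>x. \<phi> x *\<^sub>R G x \<partial>lborel)"
    by (rule int) (use c2 \<phi>0 in auto)
  ultimately show "(\<integral>x. v x *\<^sub>R D x \<partial>lebesgue_on U) = - (\<integral>x. \<phi> x *\<^sub>R G x \<partial>lebesgue_on U)"
    by simp
qed

section \<open>Lebesgue spaces on subsets and over finite measures\<close>

lemma integrable_restrict_space_subset:
  fixes f :: "'a \<Rightarrow> 'b::{banach, second_countable_topology}"
  assumes "integrable (restrict_space M T) f" "S \<subseteq> T" "S \<in> sets M" "T \<in> sets M"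
  shows "integrable (restrict_space M S) f"
proof -
  have sub: "T \<subseteq> space M" "S \<subseteq> space M"
    using assms(3,4) sets.sets_into_space by blast+
  have "integrable M (\<lambda>x. indicator T x *\<^sub>R f x)"
    using assms(1,4) sub integrable_restrict_space[of T M f] by (simp add: Int_absorb2)
  then have "integrable M (\<lambda>x. indicator S x *\<^sub>R (indicator T x *\<^sub>R f x))"
    by (rule integrable_mult_indicator[OF assms(3)])
  also have "(\<lambda>x. indicator S x *\<^sub>R (indicator T x *\<^sub>R f x)) = (\<lambda>x. indicator S x *\<^sub>R f x)"
    using assms(2) by (intro ext) (auto split: split_indicator)
  finally show ?thesis
    using assms(3) sub integrable_restrict_space[of S M f] by (simp add: Int_absorb2)
qed

lemma in_Lp_restrict_space_subset:
  assumes "in_Lp p (restrict_space M T) f" "S \<subseteq> T" "S \<in> sets M" "T \<in> sets M"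
  shows "in_Lp p (restrict_space M S) f"
  unfolding in_Lp_def
proof
  show "f \<in> borel_measurable (restrict_space M S)"
    using assms(1,2) unfolding in_Lp_def by (blast intro: measurable_restrict_mono[of f M T borel S])
  have "integrable (restrict_space M T) (\<lambda>x. norm (f x) powr p)"
    using assms(1) unfolding in_Lp_def by (rule conjunct2)
  then show "integrable (restrict_space M S) (\<lambda>x. norm (f x) powr p)"
    using assms(2-4) by (rule integrable_restrict_space_subset)
qed

text \<open>The bound t \<le> 1 + t^p for t \<ge> 0 gives an integrable majorant when the measure is
  finite. It serves to integrate the Dirichlet datum over a facet.\<close>

lemma in_Lp_imp_integrable:
  fixes f :: "'a \<Rightarrow> 'b::{banach, second_countable_topology}"
  assumes "finite_measure M" "1 \<le> p" "in_Lp p M f"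
  shows "integrable M f"
proof (rule Bochner_Integration.integrable_bound)
  interpret finite_measure M by fact
  show "integrable M (\<lambda>x. 1 + norm (f x) powr p)"
    using assms(3) by (simp add: in_Lp_def)
  show "f \<in> borel_measurable M"
    using assms(3) by (simp add: in_Lp_def)
  have "t \<le> 1 + t powr p" if "t \<ge> 0" for t :: real
  proof (cases "t \<le> 1")
    case False
    then have "t powr 1 \<le> t powr p"
      using assms(2) by (intro powr_mono) auto
    then show ?thesis
      using False by simp
  qed (simp add: add_increasing2)
  then show "AE x in M. norm (f x) \<le> norm (1 + norm (f x) powr p)"
    by (intro AE_I2) simp
qed

lemma in_Lp_1_imp_integrable:
  fixes f :: "'a \<Rightarrow> 'b::{banach, second_countable_topology}"
  assumes "in_Lp 1 M f"
  shows "integrable M f"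
  using assms integrable_norm_cancel[of M f] by (simp add: in_Lp_def)

lemma in_Lp_bounded:
  fixes f :: "'a \<Rightarrow> 'b::real_normed_vector"
  assumes "finite_measure M" "f \<in> borel_measurable M" "AE x in M. norm (f x) \<le> B" "0 \<le> p"
  shows "in_Lp p M f"
  unfolding in_Lp_def
proof
  interpret finite_measure M by fact
  have "AE x in M. norm (norm (f x) powr p) \<le> B powr p"
    using assms(3) by eventually_elim (simp add: powr_mono2 assms(4))
  then show "integrable M (\<lambda>x. norm (f x) powr p)"
    using assms(2) by (intro integrable_const_bound) auto
qed (fact assms)

lemma continuous_bounded_on_bounded:
  fixes f :: "'a::euclidean_space \<Rightarrow> 'b::real_normed_vector"
  assumes "continuous_on UNIV f" "bounded S"
  obtains B where "\<And>x. x \<in> S \<Longrightarrow> norm (f x) \<le> B"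
proof -
  have "bounded (f ` closure S)"
    using assms by (intro compact_imp_bounded compact_continuous_image)
      (auto simp: compact_closure intro: continuous_on_subset)
  then obtain B where "\<And>x. x \<in> closure S \<Longrightarrow> norm (f x) \<le> B"
    by (auto simp: bounded_iff)
  then show ?thesis
    using that closure_subset by blast
qed

lemma finite_measure_lebesgue_on_bounded:
  fixes S :: "'a::euclidean_space set"
  assumes "bounded S" "S \<in> sets lebesgue"
  shows "finite_measure (lebesgue_on S)"
proof (rule finite_measureI)
  have "emeasure lebesgue S \<noteq> \<infinity>"
    using fmeasurableD2[OF bounded_set_imp_lmeasurable[OF assms]] by simp
  then show "emeasure (lebesgue_on S) (space (lebesgue_on S)) \<noteq> \<infinity>"
    using assms(2) by (subst emeasure_restrict_space) (auto simp: space_restrict_space)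
qed

lemma in_Lp_lebesgue_on_continuous:
  fixes f :: "'a::euclidean_space \<Rightarrow> 'b::euclidean_space"
  assumes "bounded S" "S \<in> sets lebesgue" "continuous_on UNIV f" "\<And>x. x \<in> S \<Longrightarrow> v x = f x" "0 \<le> p"
  shows "in_Lp p (lebesgue_on S) v"
proof -
  obtain B where "\<And>x. x \<in> S \<Longrightarrow> norm (f x) \<le> B"
    using continuous_bounded_on_bounded assms(1,3) by blast
  then have B: "AE x in lebesgue_on S. norm (v x) \<le> B"
    using assms(4) by (intro AE_I2) (simp add: space_restrict_space)
  have "f \<in> borel_measurable (lebesgue_on S)"
    using assms(2,3) continuous_on_subset
    by (intro continuous_imp_measurable_on_sets_lebesgue) blast+
  then have "v \<in> borel_measurable (lebesgue_on S)"
    by (rule measurable_cong[THEN iffD1, rotated]) (simp add: space_restrict_space assms(4))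
  then show ?thesis
    using in_Lp_bounded[OF finite_measure_lebesgue_on_bounded] B assms by blast
qed

text \<open>The classical gradient of \<open>f\<close> is the weak gradient of \<open>v\<close>;
  both are bounded on \<open>U\<close>, being given by continuous functions on a compact
  closure.\<close>

lemma in_W1p_smooth:
  assumes "open U" "bounded U" "smooth f" "\<And>x. x \<in> U \<Longrightarrow> v x = f x" "0 \<le> p"
  shows "in_W1p p U v"
proof -
  obtain G where G: "\<And>x. GDERIV f x :> G x"
    using smooth_has_gradient assms(3) by blast
  then have "continuous_on UNIV f" "continuous_on UNIV G"
    using assms(3) smooth_continuous smooth_gradient_continuous by blast+
  moreover have "U \<in> sets lebesgue"
    using assms(1) by simp
  ultimately have "in_Lp p (lebesgue_on U) v" "in_Lp p (lebesgue_on U) G"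
    using assms by (auto intro: in_Lp_lebesgue_on_continuous)
  moreover have "weak_gradient U v G"
    using assms G by (blast intro: weak_gradient_smooth)
  ultimately show ?thesis
    unfolding in_W1p_def by blast
qed

section \<open>Length of edges and traces\<close>

text \<open>\<open>measure_of\<close> keeps the generated sigma-algebra whatever the set function
  is, so Borel sets are measurable without any appeal to countable additivity.\<close>

lemma sets_length_measure [simp, measurable_cong]: "sets length_measure = sets borel"
  unfolding length_measure_def
  by (metis sets.sigma_sets_eq sets_measure_of space_borel top_greatest Pow_UNIV)

lemma space_length_measure [simp]: "space length_measure = UNIV"
  unfolding length_measure_def by (simp add: space_measure_of_conv)

text \<open>Only an inequality: the value of \<open>measure_of\<close> is 0 unless the Hausdorff outer measure is
  known to be countably additive on the Borel sets, which is not needed here.\<close>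
lemma emeasure_length_measure_le:
  "emeasure length_measure A \<le> (SUP \<delta>\<in>{0<..}. hausdorff1_pre \<delta> A)"
  unfolding length_measure_def by (simp add: emeasure_measure_of_conv)

lemma diameter_closed_segment_le:
  fixes a b :: "'a::real_normed_vector"
  shows "diameter (closed_segment a b) \<le> dist a b"
proof (rule diameter_le)
  fix x y assume "x \<in> closed_segment a b" "y \<in> closed_segment a b"
  then obtain u v where u: "0 \<le> u" "u \<le> 1" "x = (1 - u) *\<^sub>R a + u *\<^sub>R b"
    and v: "0 \<le> v" "v \<le> 1" "y = (1 - v) *\<^sub>R a + v *\<^sub>R b"
    by (auto simp: in_segment)
  have "x - y = (v - u) *\<^sub>R (a - b)"
    unfolding u(3) v(3) by (simp add: algebra_simps)
  then have "norm (x - y) = \<bar>v - u\<bar> * dist a b"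
    by (simp add: dist_norm)
  also have "\<dots> \<le> dist a b"
    using u v by (intro mult_left_le_one_le) auto
  finally show "norm (x - y) \<le> dist a b" .
qed simp

text \<open>Cutting the segment into n equal pieces, with n so large that each has length at most
  \<delta>, gives an admissible cover of total diameter at most \<open>dist a b\<close>.\<close>

lemma hausdorff1_pre_closed_segment:
  fixes a b :: "'a::real_normed_vector"
  assumes "0 < \<delta>"
  shows "hausdorff1_pre \<delta> (closed_segment a b) \<le> ennreal (dist a b)"
proof -
  obtain n where n: "dist a b / \<delta> < real n"
    using reals_Archimedean2 by blast
  moreover have "0 \<le> dist a b / \<delta>"
    using assms by simp
  ultimately have n_pos: "n > 0"
    by (metis gr0I leD of_nat_0)
  define P where "P i = a + (real i / real n) *\<^sub>R (b - a)" for i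
  \<comment> \<open>Covers are infinite sequences, so the n pieces are padded with empty sets, whose
    diameter is 0.\<close>
  define U where "U i = (if i < n then closed_segment (P i) (P (Suc i)) else {})" for i
  have dP: "dist (P i) (P (Suc i)) = dist a b / n" for i
  proof -
    have "P (Suc i) - P i = (1 / real n) *\<^sub>R (b - a)"
      by (simp add: P_def add_divide_distrib scaleR_left_distrib)
    then show ?thesis
      by (simp add: dist_norm norm_minus_commute[of "P i"] norm_minus_commute[of a])
  qed
  have diam: "diameter (U i) \<le> (if i < n then dist a b / n else 0)" for i
    using diameter_closed_segment_le[of "P i" "P (Suc i)"] by (simp add: U_def dP)
  have cover: "closed_segment a b \<subseteq> (\<Union>i. U i)"
  proof
    fix x assume "x \<in> closed_segment a b"
    then obtain u where u: "0 \<le> u" "u \<le> 1" "x = a + u *\<^sub>R (b - a)"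
      by (auto simp: in_segment algebra_simps)
    \<comment> \<open>The piece containing \<open>x\<close>. The minimum matters at u = 1, where the
      floor is n but the last piece has index n - 1.\<close>
    define i where "i = min (nat \<lfloor>u * n\<rfloor>) (n - 1)"
    have i: "i < n" "real i \<le> u * n" "u * n \<le> real (Suc i)"
    proof -
      show "i < n"
        using n_pos by (simp add: i_def)
      have "real (nat \<lfloor>u * n\<rfloor>) \<le> u * n"
        using u(1) by simp
      then show "real i \<le> u * n"
        by (simp add: i_def min_def)
      have "u * n \<le> n"
        using u(2) n_pos by (simp add: mult_left_le_one_le u(1))
      then show "u * n \<le> real (Suc i)"
        using u(1) n_pos unfolding i_def by linarith
    qed
    define s where "s = u * n - i"
    have s: "0 \<le> s" "s \<le> 1"
      using i by (auto simp: s_def)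
    have "u = (real i + s) / n"
      using n_pos by (simp add: s_def)
    moreover have "P i + s *\<^sub>R (P (Suc i) - P i) = a + ((real i + s) / n) *\<^sub>R (b - a)"
      by (simp add: P_def add_divide_distrib scaleR_left_distrib)
    ultimately have "x = P i + s *\<^sub>R (P (Suc i) - P i)"
      using u(3) by simp
    then have "x \<in> closed_segment (P i) (P (Suc i))"
      using s by (auto simp: in_segment algebra_simps intro!: exI[of _ s])
    then show "x \<in> (\<Union>i. U i)"
      using i(1) by (auto simp: U_def intro!: exI[of _ i])
  qed
  have "dist a b / n \<le> \<delta>"
    using n n_pos assms by (simp add: field_simps)
  then have "U \<in> {U. closed_segment a b \<subseteq> (\<Union>i. U i) \<and> (\<forall>i. bounded (U i) \<and> diameter (U i) \<le> \<delta>)}"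
    using cover order_trans[OF diam] assms by (auto simp: U_def bounded_closed_segment)
  then have "hausdorff1_pre \<delta> (closed_segment a b) \<le> (\<Sum>i. ennreal (diameter (U i)))"
    unfolding hausdorff1_pre_def by (rule INF_lower)
  also have "\<dots> = (\<Sum>i<n. ennreal (diameter (U i)))"
    by (intro suminf_finite) (auto simp: U_def)
  also have "\<dots> \<le> (\<Sum>i<n. ennreal (dist a b / n))"
    using diam by (intro sum_mono ennreal_leI) (simp, metis)
  also have "\<dots> = ennreal (dist a b)"
    using n_pos by (simp add: sum_constant ennreal_of_nat_eq_real_of_nat flip: ennreal_mult)
  finally show ?thesis .
qed

lemma emeasure_length_closed_segment:
  fixes a b :: "'a::real_normed_vector"
  shows "emeasure length_measure (closed_segment a b) \<le> ennreal (dist a b)"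
  by (rule order_trans[OF emeasure_length_measure_le])
     (auto intro: SUP_least hausdorff1_pre_closed_segment)

section \<open>Finite length of triangle boundaries and traces of smooth functions\<close>

lemma simplex_2_triangle:
  assumes "2 simplex K"
  obtains a b c where "K = convex hull {a, b, c}"
proof -
  obtain C where C: "int (card C) = 3" "K = convex hull C"
    using assms unfolding simplex_def by auto
  then have "card C = 3"
    by simp
  then show ?thesis
    using that C(2) by (metis card_3_iff)
qed

text \<open>The frontier consists of three edges, each no longer than the distance of its end
  points; subadditivity adds up these upper bounds.\<close>

lemma emeasure_length_frontier_simplex:
  fixes K :: "(real^2) set"
  assumes "2 simplex K"
  shows "emeasure length_measure (frontier K) < \<infinity>"
proof -
  obtain a b c where K: "K = convex hull {a, b, c}"
    using simplex_2_triangle assms by blast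
  have seg: "closed_segment x y \<in> sets length_measure" for x y :: "real^2"
    by (simp add: borel_closed)
  have fin: "emeasure length_measure (closed_segment x y) < \<infinity>" for x y :: "real^2"
    using emeasure_length_closed_segment[of x y] by (rule le_less_trans) simp
  have "frontier K = closed_segment a b \<union> closed_segment b c \<union> closed_segment c a"
    unfolding K by (rule frontier_of_triangle) simp
  then have "emeasure length_measure (frontier K) \<le>
      emeasure length_measure (closed_segment a b \<union> closed_segment b c) +
      emeasure length_measure (closed_segment c a)"
    using seg by (simp add: emeasure_subadditive)
  also have "\<dots> \<le> emeasure length_measure (closed_segment a b) +
      emeasure length_measure (closed_segment b c) + emeasure length_measure (closed_segment c a)"
    using seg by (intro add_mono emeasure_subadditive) auto
  also have "\<dots> < \<infinity>"
    using fin by (simp add: less_top)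
  finally show ?thesis .
qed

lemma finite_measure_length_on_subset:
  assumes "S \<subseteq> T" "S \<in> sets borel" "T \<in> sets borel" "emeasure length_measure T < \<infinity>"
  shows "finite_measure (length_on S)"
proof (rule finite_measureI)
  have "emeasure length_measure S \<le> emeasure length_measure T"
    using assms by (intro emeasure_mono) auto
  then have "emeasure length_measure S < \<infinity>"
    using assms(4) by (rule le_less_trans)
  then show "emeasure (length_on S) (space (length_on S)) \<noteq> \<infinity>"
    using assms(2) by (simp add: space_restrict_space emeasure_restrict_space)
qed

text \<open>The constant sequence with value \<open>f\<close> is an admissible approximation, with
  all three distances equal to 0. This provides the witness that the choice in
  \<open>trace_on\<close> requires.\<close>

lemma is_trace_smooth:
  assumes K: "2 simplex K" and f: "smooth f" "\<And>x. x \<in> interior K \<Longrightarrow> v x = f x"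
  shows "is_trace K v f"
proof -
  obtain G where G: "\<And>x. GDERIV f x :> G x"
    using smooth_has_gradient f(1) by blast
  have fc: "continuous_on UNIV f" and Gc: "continuous_on UNIV G"
    using f(1) G smooth_continuous smooth_gradient_continuous by blast+
  have Kb: "bounded (interior K)" "bounded (frontier K)"
    using compact_imp_bounded[OF compact_simplex[OF K]]
      bounded_subset[OF _ frontier_subset_compact[OF compact_simplex[OF K]]]
    by (simp_all add: bounded_interior)
  have sets: "interior K \<in> sets lebesgue"
    by simp
  have v: "in_Lp 1 (lebesgue_on (interior K)) v"
    by (rule in_Lp_lebesgue_on_continuous[OF Kb(1) sets fc f(2)]) auto
  have GL: "in_Lp 1 (lebesgue_on (interior K)) G"
    by (rule in_Lp_lebesgue_on_continuous[OF Kb(1) sets Gc]) auto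
  have t: "in_Lp 1 (length_on (frontier K)) f"
  proof -
    obtain B where "\<And>x. x \<in> frontier K \<Longrightarrow> norm (f x) \<le> B"
      using continuous_bounded_on_bounded fc Kb(2) by blast
    then have "AE x in length_on (frontier K). norm (f x) \<le> B"
      by (intro AE_I2) (simp add: space_restrict_space)
    moreover have "f \<in> borel_measurable (length_on (frontier K))"
      using borel_measurable_continuous_onI[OF fc]
      by (intro measurable_restrict_space1) (simp cong: measurable_cong_sets)
    moreover have "finite_measure (length_on (frontier K))"
      using emeasure_length_frontier_simplex[OF K]
      by (intro finite_measure_length_on_subset[OF order_refl]) (auto simp: borel_closed)
    ultimately show ?thesis
      by (intro in_Lp_bounded) auto
  qed
  have wg: "weak_gradient (interior K) v G"
    using f G by (intro weak_gradient_smooth) auto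
  have fv: "Lp_norm 1 (lebesgue_on (interior K)) (\<lambda>x. f x - v x) = 0"
  proof -
    have "(\<integral>x. norm (f x - v x) powr 1 \<partial>lebesgue_on (interior K)) =
        (\<integral>x. 0 \<partial>lebesgue_on (interior K))"
      by (rule Bochner_Integration.integral_cong) (auto simp: space_restrict_space f(2))
    then show ?thesis
      by (simp add: Lp_norm_def)
  qed
  show ?thesis
    unfolding is_trace_def
  proof (intro conjI exI)
    show "\<forall>n::nat. smooth f" "\<forall>(n::nat) x. GDERIV f x :> G x"
      using f(1) G by auto
    show "(\<lambda>n::nat. Lp_norm 1 (lebesgue_on (interior K)) (\<lambda>x. f x - v x)) \<longlonglongrightarrow> 0"
      by (simp only: fv tendsto_const)
    show "(\<lambda>n::nat. Lp_norm 1 (lebesgue_on (interior K)) (\<lambda>x. G x - G x)) \<longlonglongrightarrow> 0"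
      "(\<lambda>n::nat. Lp_norm 1 (length_on (frontier K)) (\<lambda>x. f x - f x)) \<longlonglongrightarrow> 0"
      by (simp_all add: Lp_norm_def)
  qed (fact v t wg GL)+
qed

section \<open>Piecewise smooth functions on a mesh\<close>

text \<open>Lebesgue measure is complete, so every preimage inside \<open>Z\<close> is measurable.
  This handles the element boundaries, where a broken function is unconstrained.\<close>

lemma borel_measurable_lebesgue_on_negligible:
  fixes f :: "'a::euclidean_space \<Rightarrow> 'b::topological_space"
  assumes "negligible Z"
  shows "f \<in> borel_measurable (lebesgue_on Z)"
proof (rule measurableI)
  fix A :: "'b set"
  have "negligible (f -` A \<inter> Z)"
    using assms negligible_subset by blast
  then have "f -` A \<inter> Z \<in> sets lebesgue" "Z \<in> sets lebesgue"
    using assms negligible_imp_measurable fmeasurableD by blast+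
  then show "f -` A \<inter> space (lebesgue_on Z) \<in> sets (lebesgue_on Z)"
    by (simp add: space_restrict_space sets_restrict_space_iff)
qed simp

text \<open>The element frontiers form a null set \<open>Z\<close>, and every other point of
  \<Omega> is interior to an element. Measurability on \<Omega> is glued from the element interiors
  and \<open>Z\<close>, and the finitely many elementwise bounds give an almost everywhere bound on
  a set of finite measure.\<close>

lemma piecewise_smooth_in_broken_W1p:
  assumes \<Omega>: "bounded_domain \<Omega>" and \<T>: "simplicial_mesh \<Omega> \<T>"
    and v: "\<And>K. K \<in> \<T> \<Longrightarrow> \<exists>f. smooth f \<and> (\<forall>x\<in>interior K. v x = f x)"
    and p: "0 \<le> p"
  shows "v \<in> broken_W1p p \<Omega> \<T>"
proof -
  have fin: "finite \<T>" and K: "\<And>K. K \<in> \<T> \<Longrightarrow> 2 simplex K" and cov: "\<Union>\<T> = closure \<Omega>"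
    using \<T> by (auto simp: simplicial_mesh_def)
  have \<Omega>': "bounded \<Omega>" "\<Omega> \<in> sets lebesgue"
    using \<Omega> by (auto simp: bounded_domain_def)
  have Kb: "bounded (interior K)" if "K \<in> \<T>" for K
    using K[OF that] by (blast intro: bounded_interior compact_imp_bounded compact_simplex)
  obtain f where f: "\<And>K. K \<in> \<T> \<Longrightarrow> smooth (f K)" "\<And>K x. K \<in> \<T> \<Longrightarrow> x \<in> interior K \<Longrightarrow> v x = f K x"
    using v by metis
  define Z where "Z = (\<Union>K\<in>\<T>. frontier K)"
  have Z: "negligible Z"
    unfolding Z_def using fin K
    by (intro negligible_Union) (auto intro: negligible_convex_frontier convex_simplex)
  have split: "\<exists>K\<in>\<T>. x \<in> interior K" if "x \<in> \<Omega>" "x \<notin> Z" for x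
  proof -
    have "x \<in> \<Union>\<T>"
      unfolding cov using that(1) closure_subset by blast
    then obtain L where "L \<in> \<T>" "x \<in> L"
      by blast
    then show ?thesis
      using that(2) closure_subset[of L] by (auto simp: Z_def frontier_def)
  qed
  have Lp_interior: "in_Lp p (lebesgue_on (\<Omega> \<inter> interior K)) v" if "K \<in> \<T>" for K
    using that f \<Omega>' by (intro in_Lp_lebesgue_on_continuous[where f = "f K"])
      (auto simp: smooth_continuous p intro: bounded_Int)
  have "v \<in> borel_measurable (lebesgue_on \<Omega>)"
  proof (rule measurable_piecewise_restrict[where C = "insert Z (interior ` \<T>)"])
    show "countable (insert Z (interior ` \<T>))"
      using fin by (simp add: countable_finite)
    show "space (lebesgue_on \<Omega>) \<subseteq> \<Union> (insert Z (interior ` \<T>))"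
      using split by (auto simp: space_restrict_space)
    have "Z \<in> sets lebesgue"
      using Z negligible_imp_measurable fmeasurableD by blast
    then show "A \<inter> space (lebesgue_on \<Omega>) \<in> sets (lebesgue_on \<Omega>)"
      if "A \<in> insert Z (interior ` \<T>)" for A
      using that \<Omega>' by (auto simp: space_restrict_space sets_restrict_space_iff)
    show "v \<in> borel_measurable (restrict_space (lebesgue_on \<Omega>) A)"
      if A: "A \<in> insert Z (interior ` \<T>)" for A
    proof (cases "A = Z")
      case True
      have "negligible (\<Omega> \<inter> Z)"
        using Z negligible_Int by blast
      then show ?thesis
        unfolding True using \<Omega>'(2) \<open>Z \<in> sets lebesgue\<close>
        by (subst restrict_restrict_space) (auto intro: borel_measurable_lebesgue_on_negligible)
    next
      case False
      then obtain L where "L \<in> \<T>" "A = interior L"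
        using A by blast
      then show ?thesis
        using \<Omega>'(2) Lp_interior[of L]
        by (subst restrict_restrict_space) (auto simp: in_Lp_def)
    qed
  qed
  moreover obtain B where "AE x in lebesgue_on \<Omega>. norm (v x) \<le> B"
  proof -
    have "\<exists>b. \<forall>x\<in>interior K. norm (v x) \<le> b" if "K \<in> \<T>" for K
      using continuous_bounded_on_bounded[OF smooth_continuous[OF f(1)] Kb, of K] f(2)[of K] that
      by metis
    then obtain b where b: "\<And>K x. K \<in> \<T> \<Longrightarrow> x \<in> interior K \<Longrightarrow> norm (v x) \<le> b K"
      by metis
    \<comment> \<open>The sum stands in for the maximum of the elementwise bounds; absolute values
      ensure that each summand is at most the sum.\<close>
    have "norm (v x) \<le> (\<Sum>K\<in>\<T>. \<bar>b K\<bar>)" if x: "x \<in> \<Omega>" "x \<notin> Z" for x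
    proof -
      obtain L where L: "L \<in> \<T>" "x \<in> interior L"
        using split x by blast
      then have "norm (v x) \<le> \<bar>b L\<bar>"
        using b abs_ge_self order_trans by blast
      also have "\<dots> \<le> (\<Sum>K\<in>\<T>. \<bar>b K\<bar>)"
        using L(1) fin by (intro member_le_sum) auto
      finally show ?thesis .
    qed
    then have "AE x in lebesgue. x \<in> \<Omega> \<longrightarrow> norm (v x) \<le> (\<Sum>K\<in>\<T>. \<bar>b K\<bar>)"
      using Z by (intro AE_I'[of Z]) (auto simp: negligible_iff_null_sets)
    then show ?thesis
      using that \<Omega>'(2) by (subst (asm) AE_restrict_space_iff[symmetric]) auto
  qed
  ultimately have "in_Lp p (lebesgue_on \<Omega>) v"
    using finite_measure_lebesgue_on_bounded \<Omega>' p in_Lp_bounded by blast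
  moreover have "in_W1p p (interior K) v" if "K \<in> \<T>" for K
    using that f Kb p by (intro in_W1p_smooth) auto
  ultimately show ?thesis
    by (simp add: broken_W1p_def)
qed

text \<open>Existence of one trace makes the one selected by \<open>trace_on\<close> a trace too.
  The selected function may differ from \<open>f\<close>, so its integrability is read off
  \<open>is_trace\<close>.\<close>

lemma trace_on_integrable:
  assumes "2 simplex K" "smooth f" "\<And>x. x \<in> interior K \<Longrightarrow> v x = f x"
  shows "integrable (length_on (frontier K)) (trace_on K v)"
proof -
  have "is_trace K v f"
    using assms by (rule is_trace_smooth)
  then have "is_trace K v (trace_on K v)"
    unfolding trace_on_def by (rule someI[of "is_trace K v"])
  then show ?thesis
    using in_Lp_1_imp_integrable by (auto simp: is_trace_def)
qed

section \<open>Facets on the boundary of the domain\<close>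

lemma boundary_facet_subset_frontier:
  assumes "simplicial_mesh \<Omega> \<T>" "F \<in> boundary_facets \<Omega> \<T>"
  shows "\<exists>K\<in>\<T>. F \<subseteq> frontier K"
proof -
  obtain K E where K: "K \<in> \<T>" "E facet_of K" "F \<subseteq> E"
    using assms(2) by (auto simp: boundary_facets_def)
  have "2 simplex K"
    using assms(1) K(1) by (simp add: simplicial_mesh_def)
  \<comment> \<open>A triangle is full-dimensional in the plane, so its relative frontier, which
    contains all proper faces, is its topological frontier.\<close>
  then have "aff_dim K = int DIM(real^2)"
    by (simp add: aff_dim_simplex)
  then have "rel_frontier K = frontier K"
    by (rule rel_frontier_frontier[OF aff_dim_eq_full[THEN iffD1]])
  moreover have "E \<subseteq> rel_frontier K"
    using K(2) facet_of_irrefl by (intro face_of_subset_rel_frontier) (auto simp: facet_of_def)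
  ultimately show ?thesis
    using K by blast
qed

lemma boundary_facet_closed:
  assumes "simplicial_mesh \<Omega> \<T>" "F \<in> boundary_facets \<Omega> \<T>"
  shows "closed F"
proof -
  obtain K E where K: "K \<in> \<T>" "E facet_of K" "F = E \<inter> frontier \<Omega>"
    using assms(2) by (auto simp: boundary_facets_def)
  then have "polytope K" "E face_of K"
    using assms(1) by (auto simp: simplicial_mesh_def facet_of_def intro: simplex_imp_polytope)
  then have "closed E"
    using face_of_polytope_polytope polytope_imp_closed by blast
  then show ?thesis
    using K(3) by (simp add: closed_Int)
qed

text \<open>Containment in \<open>frontier \<Omega>\<close> separates the two classes, so on a
  boundary facet \<open>jump\<close> takes its one-sided branch.\<close>

lemma boundary_facet_not_internal: "F \<in> boundary_facets \<Omega> \<T> \<Longrightarrow> F \<notin> internal_facets \<Omega> \<T>"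
  by (auto simp: boundary_facets_def internal_facets_def)

text \<open>The element is the very one selected inside \<open>jump\<close>; the selection succeeds
  because some element has the facet in its frontier.\<close>

lemma boundary_facet_element:
  assumes "simplicial_mesh \<Omega> \<T>" "F \<in> boundary_facets \<Omega> \<T>"
  obtains K where "K \<in> \<T>" "2 simplex K" "F \<subseteq> frontier K" "jump \<Omega> \<T> nF F v = trace_on K v"
proof -
  define K where "K = (SOME K. K \<in> \<T> \<and> F \<subseteq> frontier K)"
  have "K \<in> \<T> \<and> F \<subseteq> frontier K"
    unfolding K_def using boundary_facet_subset_frontier[OF assms] unfolding Bex_def by (rule someI_ex)
  moreover from this have "2 simplex K"
    using assms(1) by (simp add: simplicial_mesh_def)
  moreover have "jump \<Omega> \<T> nF F v = trace_on K v"
    using boundary_facet_not_internal[OF assms(2)] by (simp add: jump_def fun_eq_iff K_def)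
  ultimately show ?thesis
    using that by blast
qed

section \<open>Facet averages and broken norm of Crouzeix-Raviart functions\<close>

lemma CR_space_piecewise_smooth:
  assumes "q \<in> CR_space k g \<Omega> \<Gamma>D \<T> nF" "K \<in> \<T>"
  shows "\<exists>f. smooth f \<and> (\<forall>x\<in>interior K. q x = f x)"
  using assms smooth_poly_le unfolding CR_space_def by blast

lemma CR_space_facet_average_internal:
  assumes "q \<in> CR_space k g \<Omega> \<Gamma>D \<T> nF" "F \<in> internal_facets \<Omega> \<T>"
  shows "facet_average F (jump \<Omega> \<T> nF F q) = (\<lambda>_. 0)"
proof -
  have "(\<integral>x. jump \<Omega> \<T> nF F q x * 1 \<partial>length_on F) = 0"
    using assms poly_le_one unfolding CR_space_def by blast
  then show ?thesis
    by (simp add: facet_average_def)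
qed

text \<open>Here \<open>r\<close> is the integrability exponent of the datum, instantiated with
  \<alpha>/(\<alpha> - 1) later. Since \<open>F\<close> inherits finite length from the frontier of
  its element, the datum is integrable on \<open>F\<close>.\<close>

lemma CR_space_facet_average_dirichlet:
  assumes \<T>: "simplicial_mesh \<Omega> \<T>"
    and g: "1 \<le> r" "in_Lp r (length_on \<Gamma>D) g" "\<Gamma>D \<in> sets borel"
    and q: "q \<in> CR_space k g \<Omega> \<Gamma>D \<T> nF" and F: "F \<in> dirichlet_facets \<Omega> \<Gamma>D \<T>"
  shows "facet_average F (jump \<Omega> \<T> nF F q) = facet_average F g"
proof -
  have Fb: "F \<in> boundary_facets \<Omega> \<T>" "F \<subseteq> \<Gamma>D"
    using F by (auto simp: dirichlet_facets_def)
  obtain K where K: "K \<in> \<T>" "2 simplex K" "F \<subseteq> frontier K" "jump \<Omega> \<T> nF F q = trace_on K q"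
    using boundary_facet_element[OF \<T> Fb(1)] by blast
  have borel: "F \<in> sets borel" "frontier K \<in> sets borel"
    using boundary_facet_closed[OF \<T> Fb(1)] by (auto simp: borel_closed)
  have fm: "finite_measure (length_on F)"
    using finite_measure_length_on_subset[OF K(3) borel] emeasure_length_frontier_simplex[OF K(2)] .
  obtain f where "smooth f" "\<And>x. x \<in> interior K \<Longrightarrow> q x = f x"
    using CR_space_piecewise_smooth[OF q K(1)] by blast
  then have "integrable (length_on (frontier K)) (trace_on K q)"
    using trace_on_integrable[OF K(2)] by blast
  \<comment> \<open>The trace is integrable over the whole frontier of \<open>K\<close>, hence over
    the Borel subset \<open>F\<close>.\<close>
  then have jump: "integrable (length_on F) (jump \<Omega> \<T> nF F q)"
    unfolding K(4) using borel by (intro integrable_restrict_space_subset[OF _ K(3)]) auto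
  have "in_Lp r (length_on F) g"
    using borel(1) g(3) by (intro in_Lp_restrict_space_subset[OF g(2) Fb(2)]) auto
  then have g_int: "integrable (length_on F) g"
    using in_Lp_imp_integrable fm g(1) by blast
  have "(\<integral>x. (jump \<Omega> \<T> nF F q x - g x) * 1 \<partial>length_on F) = 0"
    using q F poly_le_one unfolding CR_space_def by blast
  then have "(\<integral>x. jump \<Omega> \<T> nF F q x \<partial>length_on F) = (\<integral>x. g x \<partial>length_on F)"
    using jump g_int by simp
  then show ?thesis
    by (simp add: facet_average_def)
qed

text \<open>Finiteness of the facet set is not established here. For a finite set the two sides
  agree, while for an infinite one the convention for sums yields an inequality, which is all that
  the final bounds require.\<close>

lemma CR_space_broken_norm_le:
  assumes \<T>: "simplicial_mesh \<Omega> \<T>" and p: "0 < p"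
    and g: "1 \<le> r" "in_Lp r (length_on \<Gamma>D) g" "\<Gamma>D \<in> sets borel"
    and q: "q \<in> CR_space k g \<Omega> \<Gamma>D \<T> nF"
  shows "broken_norm p \<Omega> \<Gamma>D \<T> nF q \<le>
    Lp_norm p (lebesgue_on \<Omega>) (broken_grad \<T> q) +
    (\<Sum>F\<in>dirichlet_facets \<Omega> \<Gamma>D \<T>.
       Lp_norm (sharp_exponent 2 p) (length_on F) (facet_average F g) powr p) powr (1 / p)"
proof -
  let ?I = "internal_facets \<Omega> \<T>" and ?D = "dirichlet_facets \<Omega> \<Gamma>D \<T>"
  let ?a = "\<lambda>F w. Lp_norm (sharp_exponent 2 p) (length_on F) (facet_average F w) powr p"
  \<comment> \<open>\<open>0 powr s\<close> is 0 for every exponent, so a zero average contributes 0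
    after each of the powers involved.\<close>
  have I: "?a F (jump \<Omega> \<T> nF F q) = 0" if "F \<in> ?I" for F
    using CR_space_facet_average_internal[OF q that] by (simp add: Lp_norm_def)
  have D: "?a F (jump \<Omega> \<T> nF F q) = ?a F g" if "F \<in> ?D" for F
    using CR_space_facet_average_dirichlet[OF \<T> g q that] by simp
  have "(\<Sum>F\<in>?I \<union> ?D. ?a F (jump \<Omega> \<T> nF F q)) \<le> (\<Sum>F\<in>?D. ?a F g)"
  proof (cases "finite (?I \<union> ?D)")
    case True
    then have "(\<Sum>F\<in>?I \<union> ?D. ?a F (jump \<Omega> \<T> nF F q)) = (\<Sum>F\<in>?D. ?a F (jump \<Omega> \<T> nF F q))"
      using I by (intro sum.mono_neutral_right) blast+
    also have "\<dots> = (\<Sum>F\<in>?D. ?a F g)"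
      by (intro sum.cong D) auto
    finally show ?thesis
      by simp
  next
    case False \<comment> \<open>the sum over an infinite set is 0\<close>
    then show ?thesis
      by (simp add: sum_nonneg)
  qed
  then show ?thesis
    unfolding broken_norm_def using p by (intro add_left_mono powr_mono2) (auto simp: sum_nonneg)
qed

text \<open>The constants are fixed before the mesh index \<open>h\<close>, so the bounds are
  uniform over the family and inherit exactly the constants of the two broken inequalities. The
  membership conjuncts keep the norms meaningful, as a non-integrable function would have integral
  0.\<close>

theorem corollary3p3:
  fixes \<Omega> \<Gamma>D \<Gamma>N :: "(real^2) set"
    and \<T> :: "'h \<Rightarrow> (real^2) set set"
    and nF :: "'h \<Rightarrow> (real^2) set \<Rightarrow> real^2"
    and \<gamma> R \<sigma> p \<alpha> C_SP C_ST :: real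
    and N k :: nat
    and gD :: "real^2 \<Rightarrow> real"
  assumes domain: "bounded_domain \<Omega>"
    and star_or_decomposition:
      "star_shaped_wrt_ball R \<Omega> \<or>
       (\<exists>\<S>. simplicial_mesh \<Omega> \<S> \<and> shape_regular \<sigma> \<S> \<and> card \<S> = N)"
    and boundary: "frontier \<Omega> = \<Gamma>D \<union> \<Gamma>N" "\<Gamma>D \<in> sets borel" "\<Gamma>N \<in> sets borel"
    and mesh: "\<And>h. simplicial_mesh \<Omega> (\<T> h)"
    and regular: "\<And>h. shape_regular \<gamma> (\<T> h)"
    and boundary_split: "\<And>h F. F \<in> boundary_facets \<Omega> (\<T> h) \<Longrightarrow> F \<subseteq> \<Gamma>D \<or> F \<subseteq> \<Gamma>N"
    and normals: "\<And>h F. F \<in> internal_facets \<Omega> (\<T> h) \<union> boundary_facets \<Omega> (\<T> h) \<Longrightarrow>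
                    unit_normal F (nF h F)"
    and p: "1 \<le> p" "p < 2"
    and \<alpha>: "2 < \<alpha>"
    and k: "1 \<le> k"
    and const_pos: "0 < C_SP" "0 < C_ST"
    and sobolev_poincare:
      "\<And>h v q. v \<in> broken_W1p p \<Omega> (\<T> h) \<Longrightarrow> 1 \<le> q \<Longrightarrow> q \<le> star_exponent 2 p \<Longrightarrow>
         in_Lp q (lebesgue_on \<Omega>) v \<and>
         Lp_norm q (lebesgue_on \<Omega>) v \<le> C_SP * broken_norm p \<Omega> \<Gamma>D (\<T> h) (nF h) v"
    and sobolev_trace:
      "\<And>h v q. v \<in> broken_W1p p \<Omega> (\<T> h) \<Longrightarrow> 1 \<le> q \<Longrightarrow> q \<le> sharp_exponent 2 p \<Longrightarrow>
         in_Lq_boundary q \<Omega> (\<T> h) v \<and>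
         Lq_norm_boundary q \<Omega> (\<T> h) v \<le> C_ST * broken_norm p \<Omega> \<Gamma>D (\<T> h) (nF h) v"
    and gD: "in_Wsp_curve (1 / \<alpha>) (\<alpha> / (\<alpha> - 1)) \<Gamma>D gD"
  shows "\<forall>h. \<forall>qh \<in> CR_space k gD \<Omega> \<Gamma>D (\<T> h) (nF h).
     (\<forall>q. 1 \<le> q \<and> q \<le> star_exponent 2 p \<longrightarrow>
        in_Lp q (lebesgue_on \<Omega>) qh \<and>
        Lp_norm q (lebesgue_on \<Omega>) qh \<le>
          C_SP * (Lp_norm p (lebesgue_on \<Omega>) (broken_grad (\<T> h) qh) +
            (\<Sum>F\<in>dirichlet_facets \<Omega> \<Gamma>D (\<T> h).
               Lp_norm (sharp_exponent 2 p) (length_on F) (facet_average F gD) powr p) powr (1 / p))) \<and>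
     (\<forall>q. 1 \<le> q \<and> q \<le> sharp_exponent 2 p \<longrightarrow>
        in_Lq_boundary q \<Omega> (\<T> h) qh \<and>
        Lq_norm_boundary q \<Omega> (\<T> h) qh \<le>
          C_ST * (Lp_norm p (lebesgue_on \<Omega>) (broken_grad (\<T> h) qh) +
            (\<Sum>F\<in>dirichlet_facets \<Omega> \<Gamma>D (\<T> h).
               Lp_norm (sharp_exponent 2 p) (length_on F) (facet_average F gD) powr p) powr (1 / p)))"
proof (intro allI ballI)
  fix h qh
  assume qh: "qh \<in> CR_space k gD \<Omega> \<Gamma>D (\<T> h) (nF h)"
  let ?data = "Lp_norm p (lebesgue_on \<Omega>) (broken_grad (\<T> h) qh) +
    (\<Sum>F\<in>dirichlet_facets \<Omega> \<Gamma>D (\<T> h).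
       Lp_norm (sharp_exponent 2 p) (length_on F) (facet_average F gD) powr p) powr (1 / p)"
  have broken: "qh \<in> broken_W1p p \<Omega> (\<T> h)"
    by (rule piecewise_smooth_in_broken_W1p[OF domain mesh])
       (use p CR_space_piecewise_smooth[OF qh] in auto)
  \<comment> \<open>The Slobodeckij space lies in the Lebesgue space with conjugate exponent
    \<alpha>/(\<alpha> - 1) by definition, and this exponent is at least 1 because \<alpha> >
    2.\<close>
  have gD': "in_Lp (\<alpha> / (\<alpha> - 1)) (length_on \<Gamma>D) gD"
    using gD by (simp add: in_Wsp_curve_def)
  have \<alpha>': "1 \<le> \<alpha> / (\<alpha> - 1)"
    using \<alpha> by simp
  have "0 < p"
    using p(1) by simp
  then have le: "broken_norm p \<Omega> \<Gamma>D (\<T> h) (nF h) qh \<le> ?data"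
    by (rule CR_space_broken_norm_le[OF mesh _ \<alpha>' gD' boundary(2) qh])
  have C: "C_SP * broken_norm p \<Omega> \<Gamma>D (\<T> h) (nF h) qh \<le> C_SP * ?data"
    "C_ST * broken_norm p \<Omega> \<Gamma>D (\<T> h) (nF h) qh \<le> C_ST * ?data"
    using le const_pos by (simp_all add: mult_left_mono)
  show "(\<forall>q. 1 \<le> q \<and> q \<le> star_exponent 2 p \<longrightarrow>
        in_Lp q (lebesgue_on \<Omega>) qh \<and> Lp_norm q (lebesgue_on \<Omega>) qh \<le> C_SP * ?data) \<and>
     (\<forall>q. 1 \<le> q \<and> q \<le> sharp_exponent 2 p \<longrightarrow>
        in_Lq_boundary q \<Omega> (\<T> h) qh \<and> Lq_norm_boundary q \<Omega> (\<T> h) qh \<le> C_ST * ?data)"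
    using sobolev_poincare[OF broken] sobolev_trace[OF broken] C by (meson order_trans)
qed

end
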